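(* Let $n\ge 1$, let $\bar d=(d_1,\dots,d_n)$ be positive integers, and put $D=d_1+\dots+d_n-n$. Let $\mathbb{K}$ be a field whose characteristic is zero or greater than $D$. Let $K_n$ be the complete graph on $n$ vertices, $w(K_n)$ its whiskering, and $A=A(w(K_n),\bar d)$. Then $A$ has the strong Lefschetz property. More precisely, with $L=x_1+\dots+x_n+y_1+\dots+y_n$, the multiplication map $\times L^s:A_i\to A_{i+s}$ is injective when $2i\le D-s$ and surjective otherwise.
   Context: For a graph $G$ on vertex set $\{1,\dots,n\}$ with edge ideal $I(G)=(x_ix_j : \{i,j\}\text{ an edge of }G)$, the whiskered graph $w(G)$ is obtained by attaching to each vertex $i$ of $G$ a new vertex adjacent only to $i$; the new vertex corresponds to the variable $y_i$. Its edge ideal is $I(w(G))=I(G)+(x_1y_1,\dots,x_ny_n)\subset\mathbb{K}[x_1,\dots,x_n,y_1,\dots,y_n]$. For positive integers $\bar d=(d_1,\dots,d_n)$, $$A(w(G),\bar d)=\frac{\mathbb{K}[x_1,\dots,x_n,y_1,\dots,y_n]}{I(w(G))+(x_1^{d_1},\dots,x_n^{d_n},y_1^{d_1},\dots,y_n^{d_n})}.$$ A graded artinian algebra $A=\bigoplus A_i$ has the strong Lefschetz property (SLP) if there is a linear form $L\in A_1$ such that all multiplication maps $\times L^s:A_i\to A_{i+s}$ have maximal rank, i.e. are injective or surjective. *)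

theory Defs
  imports
    "HOL-Algebra.Algebraic_Closure_Type"
    "HOL-Algebra.QuotRing"
    "HOL-Library.Poly_Mapping"
    "HOL-Library.Cardinality"
begin

section \<open>Polynomial rings\<close>

text \<open>
  Polynomials over \<open>'k\<close> in the variables \<open>'v\<close>: a monomial is a finitely supported exponent
  vector, a polynomial a finitely supported map from monomials to coefficients.
\<close>

type_synonym ('v, 'k) mpoly = "('v \<Rightarrow>\<^sub>0 nat) \<Rightarrow>\<^sub>0 'k"

definition var :: "'v \<Rightarrow> ('v, 'k::field) mpoly" where
  "var v = Poly_Mapping.single (Poly_Mapping.single v 1) 1"

abbreviation poly_ring :: "('v, 'k::field) mpoly ring" where
  "poly_ring \<equiv> ring_of_type_algebra"

definition mon_degree :: "('v \<Rightarrow>\<^sub>0 nat) \<Rightarrow> nat" where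
  "mon_degree m = (\<Sum>v\<in>Poly_Mapping.keys m. Poly_Mapping.lookup m v)"

definition homogeneous :: "nat \<Rightarrow> ('v, 'k::field) mpoly set" where
  "homogeneous i = {p. \<forall>m\<in>Poly_Mapping.keys p. mon_degree m = i}"

text \<open>
  The degree \<open>i\<close> component of \<open>poly_ring Quot I\<close>, for a homogeneous ideal \<open>I\<close>.
\<close>

definition quot_component :: "('v, 'k::field) mpoly set \<Rightarrow> nat \<Rightarrow> ('v, 'k) mpoly set set" where
  "quot_component I i = (\<lambda>p. I +>\<^bsub>poly_ring\<^esub> p) ` homogeneous i"


section \<open>Edge ideals and whiskered graphs\<close>

text \<open>
  A simple graph with vertex set \<open>UNIV :: 'v set\<close> is given by its set of edges, each a
  two-element set of vertices.
\<close>

definition complete_graph :: "'v set set" where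
  "complete_graph = {{i, j} |i j. i \<noteq> j}"

definition edge_ideal :: "'v set set \<Rightarrow> ('v, 'k::field) mpoly set" where
  "edge_ideal E = Idl\<^bsub>poly_ring\<^esub> {var i * var j |i j. {i, j} \<in> E}"

text \<open>
  In \<open>'v + 'v\<close>, the vertex \<open>Inl i\<close> is the original vertex \<open>i\<close> (variable \<open>x\<^sub>i\<close>) and \<open>Inr i\<close>
  is the whisker attached to it (variable \<open>y\<^sub>i\<close>).
\<close>

definition whisker :: "'v set set \<Rightarrow> ('v + 'v) set set" where
  "whisker E = {{Inl i, Inl j} |i j. {i, j} \<in> E} \<union> {{Inl i, Inr i} |i. True}"

definition whisker_ideal ::
    "'v set set \<Rightarrow> ('v \<Rightarrow> nat) \<Rightarrow> ('v + 'v, 'k::field) mpoly set" where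
  "whisker_ideal E d =
     edge_ideal (whisker E) <+>\<^bsub>poly_ring\<^esub>
     Idl\<^bsub>poly_ring\<^esub> ({var (Inl i) ^ d i |i. True} \<union> {var (Inr i) ^ d i |i. True})"

definition whisker_algebra ::
    "'v set set \<Rightarrow> ('v \<Rightarrow> nat) \<Rightarrow> ('v + 'v, 'k::field) mpoly set ring" where
  "whisker_algebra E d = poly_ring Quot whisker_ideal E d"

definition whisker_component ::
    "'v set set \<Rightarrow> ('v \<Rightarrow> nat) \<Rightarrow> nat \<Rightarrow> ('v + 'v, 'k::field) mpoly set set" where
  "whisker_component E d = quot_component (whisker_ideal E d)"

text \<open>The class of \<open>x\<^sub>1 + \<dots> + x\<^sub>n + y\<^sub>1 + \<dots> + y\<^sub>n\<close>.\<close>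

definition whisker_form ::
    "('v::finite) set set \<Rightarrow> ('v \<Rightarrow> nat) \<Rightarrow> ('v + 'v, 'k::field) mpoly set" where
  "whisker_form E d =
     whisker_ideal E d +>\<^bsub>poly_ring\<^esub> ((\<Sum>i\<in>UNIV. var (Inl i)) + (\<Sum>i\<in>UNIV. var (Inr i)))"


section \<open>The strong Lefschetz property\<close>

text \<open>
  Below, \<open>gr i\<close> is the degree \<open>i\<close> component of a graded artinian algebra \<open>A\<close>.
\<close>

definition mult_injective ::
    "('a, 'm) ring_scheme \<Rightarrow> (nat \<Rightarrow> 'a set) \<Rightarrow> 'a \<Rightarrow> nat \<Rightarrow> nat \<Rightarrow> bool" where
  "mult_injective A gr L s i \<longleftrightarrow> inj_on (\<lambda>a. L [^]\<^bsub>A\<^esub> s \<otimes>\<^bsub>A\<^esub> a) (gr i)"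

definition mult_surjective ::
    "('a, 'm) ring_scheme \<Rightarrow> (nat \<Rightarrow> 'a set) \<Rightarrow> 'a \<Rightarrow> nat \<Rightarrow> nat \<Rightarrow> bool" where
  "mult_surjective A gr L s i \<longleftrightarrow> (\<lambda>a. L [^]\<^bsub>A\<^esub> s \<otimes>\<^bsub>A\<^esub> a) ` gr i = gr (i + s)"

definition strong_lefschetz :: "('a, 'm) ring_scheme \<Rightarrow> (nat \<Rightarrow> 'a set) \<Rightarrow> bool" where
  "strong_lefschetz A gr \<longleftrightarrow>
     (\<exists>L\<in>gr 1. \<forall>s i. mult_injective A gr L s i \<or> mult_surjective A gr L s i)"

end

theory Submission
  imports Defs
begin

text \<open>
  The multiplication \<open>U\<close> by the sum of the variables on
  \<open>K[z\<^sub>1, \<dots>, z\<^sub>r] / (z\<^sub>1\<^bsup>e\<^sub>1\<^esup>, \<dots>, z\<^sub>r\<^bsup>e\<^sub>r\<^esup>)\<close> has a partner \<open>V\<close> lowering the degree such that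
  \<open>U V - V U\<close> is the scalar \<open>2 i - D\<close> in degree \<open>i\<close>, with \<open>D\<close> the socle degree. The usual \<open>sl\<^sub>2\<close>
  computations only divide by integers between \<open>1\<close> and \<open>D\<close>, so they give the strong Lefschetz
  property for these algebras in characteristic \<open>0\<close> or \<open>> D\<close>.

  Setting all \<open>x\<^sub>i\<close> to \<open>0\<close> maps \<open>A\<close> onto such an algebra of socle degree \<open>D\<close>. As \<open>x\<^sub>i x\<^sub>j = 0\<close> for
  \<open>i \<noteq> j\<close>, the kernel is the direct sum of the ideals \<open>x\<^sub>i A\<close>, and division by \<open>x\<^sub>i\<close> identifies
  \<open>x\<^sub>i A\<close>, up to a shift by one degree, with such an algebra of socle degree \<open>D - 1\<close> in \<open>x\<^sub>i\<close> and the
  \<open>y\<^sub>j\<close> with \<open>j \<noteq> i\<close>. For \<open>2 i \<le> D - s\<close> the power \<open>L\<^sup>s\<close> is injective on all these pieces, and otherwise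
  it is surjective on all of them; hence so it is on \<open>A\<close>.
\<close>

section \<open>Raising and lowering operators\<close>

text \<open>An \<open>sl\<^sub>2\<close> action modulo the subspace \<open>N\<close>: no quotient
  space is formed, and statements about the quotient become membership in \<open>N\<close>. Degrees
  and \<open>D\<close> are integers because \<open>V\<close> lowers degrees below \<open>0\<close>
  and because \<open>D = -1\<close> occurs in the application.\<close>

locale lefschetz_pair = vector_space scale
  for scale :: "'k::field \<Rightarrow> 'b::ab_group_add \<Rightarrow> 'b" +
  fixes U V :: "'b \<Rightarrow> 'b" and G :: "int \<Rightarrow> 'b set" and N :: "'b set" and D :: int
  assumes linear_U: "Vector_Spaces.linear scale scale U" and linear_V: "Vector_Spaces.linear scale scale V"
    and subspace_G: "subspace (G i)" and subspace_N: "subspace N"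
    and U_G: "v \<in> G i \<Longrightarrow> U v \<in> G (i + 1)" and V_G: "v \<in> G i \<Longrightarrow> V v \<in> G (i - 1)"
    and G_neg: "i < 0 \<Longrightarrow> G i \<subseteq> {0}" and G_large: "i > D \<Longrightarrow> G i \<subseteq> N"
    and U_N: "v \<in> N \<Longrightarrow> U v \<in> N" and V_N: "v \<in> N \<Longrightarrow> V v \<in> N"
    and commutator: "v \<in> G i \<Longrightarrow> U (V v) - V (U v) = scale (of_int (2 * i - D)) v"
    and char_large: "0 < k \<Longrightarrow> k \<le> D \<Longrightarrow> of_int k \<noteq> (0 :: 'k)"
begin

sublocale U: Vector_Spaces.linear scale scale U by (rule linear_U)
sublocale V: Vector_Spaces.linear scale scale V by (rule linear_V)

section \<open>Powers of \<open>U\<close> and \<open>V\<close>\<close>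

lemma linear_U_pow: "Vector_Spaces.linear scale scale (U ^^ s)"
proof (induction s)
  case 0
  then show ?case using linear_id by (simp add: id_def)
next
  case (Suc s)
  then show ?case using Vector_Spaces.linear_compose[OF Suc linear_U] by (simp add: o_def)
qed

sublocale U_pow: Vector_Spaces.linear scale scale "U ^^ s" for s by (rule linear_U_pow)

lemma U_pow_N: "v \<in> N \<Longrightarrow> (U ^^ s) v \<in> N"
  by (induction s) (auto intro: U_N)

lemma U_pow_G: "v \<in> G i \<Longrightarrow> (U ^^ s) v \<in> G (i + int s)"
proof (induction s)
  case (Suc s)
  then show ?case using U_G[of "(U ^^ s) v" "i + int s"] by (simp add: algebra_simps)
qed simp

lemma V_pow_G: "v \<in> G i \<Longrightarrow> (V ^^ s) v \<in> G (i - int s)"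
proof (induction s)
  case (Suc s)
  then show ?case using V_G[of "(V ^^ s) v" "i - int s"] by (simp add: algebra_simps)
qed simp

lemma mem_N_cancel:
  assumes "scale c v \<in> N" "c \<noteq> 0"
  shows "v \<in> N"
  using subspace_scale[OF subspace_N assms(1), of "inverse c"] assms(2) by simp

text \<open>The coefficients below are products of two factors, and such a product may exceed
  \<open>D\<close>; the condition on the characteristic is therefore applied to each factor.\<close>

lemma of_int_mult_nonzero:
  assumes "0 < a" "a \<le> D" "0 < b" "b \<le> D"
  shows "of_int (a * b) \<noteq> (0 :: 'k)"
  using char_large[of a] char_large[of b] assms by simp

text \<open>Moving \<open>V\<close> past one \<open>U\<close> in degree \<open>i + t\<close>
  contributes \<open>D - 2 * (i + t)\<close>; summing over \<open>t = 0, ..., s\<close> gives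
  \<open>(s + 1) * (D - 2 * i - s)\<close>.\<close>

lemma V_U_pow:
  assumes "v \<in> G i"
  shows "V ((U ^^ Suc s) v) =
    (U ^^ Suc s) (V v) + scale (of_int ((int s + 1) * (D - 2 * i - int s))) ((U ^^ s) v)"
proof (induction s)
  case 0
  have "V (U v) = U (V v) - scale (of_int (2 * i - D)) v"
    using commutator[OF assms] by (simp add: algebra_simps)
  then show ?case
    by (simp add: scale_left_diff_distrib)
next
  case (Suc s)
  have coeff: "(int s + 1) * (D - 2 * i - int s) - (2 * (i + int (Suc s)) - D) =
      (int (Suc s) + 1) * (D - 2 * i - int (Suc s))"
    by (simp add: algebra_simps)
  have "V (U ((U ^^ Suc s) v)) = U (V ((U ^^ Suc s) v)) -
      scale (of_int (2 * (i + int (Suc s)) - D)) ((U ^^ Suc s) v)"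
    using commutator[OF U_pow_G[OF assms, of "Suc s"]] by (simp only: algebra_simps)
  also have "U (V ((U ^^ Suc s) v)) = U ((U ^^ Suc s) (V v)) +
      scale (of_int ((int s + 1) * (D - 2 * i - int s))) (U ((U ^^ s) v))"
    by (simp only: Suc U.add U.scale)
  finally have "V ((U ^^ Suc (Suc s)) v) = (U ^^ Suc (Suc s)) (V v) +
      (scale (of_int ((int s + 1) * (D - 2 * i - int s))) ((U ^^ Suc s) v) -
       scale (of_int (2 * (i + int (Suc s)) - D)) ((U ^^ Suc s) v))"
    by simp
  also have "(scale (of_int ((int s + 1) * (D - 2 * i - int s))) ((U ^^ Suc s) v) -
       scale (of_int (2 * (i + int (Suc s)) - D)) ((U ^^ Suc s) v)) =
       scale (of_int ((int (Suc s) + 1) * (D - 2 * i - int (Suc s)))) ((U ^^ Suc s) v)"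
    by (simp only: scale_left_diff_distrib[symmetric] of_int_diff[symmetric] coeff)
  finally show ?case .
qed

text \<open>Outer induction on the degree, shifted so that the base case is degree
  \<open>-1\<close>, where \<open>G\<close> is zero, and inner induction on \<open>s\<close>. If
  \<open>U^(s+1) v\<close> is in \<open>N\<close>, the relation \<open>V_U_pow\<close> first forces
  \<open>V v\<close> into \<open>N\<close> and then \<open>U^s v\<close>.\<close>

lemma U_pow_injective_nat:
  assumes "v \<in> G (int n - 1)" "(U ^^ s) v \<in> N" "2 * (int n - 1) + int s \<le> D"
  shows "v \<in> N"
  using assms
proof (induction n arbitrary: v s)
  case 0
  then show ?case using G_neg[of "- 1"] subspace_0[OF subspace_N] by auto
next
  case (Suc n)
  have v: "v \<in> G (int n)" using Suc.prems(1) by simp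
  note IH = Suc.IH
  from Suc.prems(2,3) show ?case
  proof (induction s)
    case (Suc s)
    let ?c = "(int s + 1) * (D - 2 * int n - int s)"
    note VU = V_U_pow[OF v, of s]
    have "V ((U ^^ Suc s) v) \<in> N" using Suc.prems(1) by (rule V_N)
    then have sum_N: "(U ^^ Suc s) (V v) + scale (of_int ?c) ((U ^^ s) v) \<in> N"
      using VU by simp
    \<comment> \<open>Another \<open>U\<close> turns the second summand into a multiple of
      \<open>U^(s+1) v\<close>, which is in \<open>N\<close>, so only the term with
      \<open>V v\<close> remains.\<close>
    have "U ((U ^^ Suc s) (V v)) + scale (of_int ?c) ((U ^^ Suc s) v) \<in> N"
      using U_N[OF sum_N] by (simp add: U.add U.scale)
    from subspace_diff[OF subspace_N this subspace_scale[OF subspace_N Suc.prems(1)], of "of_int ?c"]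
    have "(U ^^ Suc (Suc s)) (V v) \<in> N" by simp
    \<comment> \<open>One degree less makes room for two more powers of \<open>U\<close>:
      \<open>2 * (n - 1) + (s + 2) = 2 * n + s\<close>.\<close>
    then have "V v \<in> N"
      using V_G[OF v] Suc.prems(2) \<open>(U ^^ Suc (Suc s)) (V v) \<in> N\<close> by (intro IH[of "V v" "Suc (Suc s)"]) auto
    from subspace_diff[OF subspace_N sum_N U_pow_N[OF this, of "Suc s"]]
    have "scale (of_int ?c) ((U ^^ s) v) \<in> N" by simp
    then have "(U ^^ s) v \<in> N"
      by (rule mem_N_cancel) (rule of_int_mult_nonzero, use Suc.prems(2) in auto)
    then show ?case using Suc.IH Suc.prems by simp
  qed simp
qed

theorem U_pow_injective:
  assumes "v \<in> G i" "(U ^^ s) v \<in> N" "2 * i + int s \<le> D"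
  shows "v \<in> N"
proof (cases "i < 0")
  case True
  then show ?thesis using G_neg[of i] assms(1) subspace_0[OF subspace_N] by auto
next
  case False
  then show ?thesis using U_pow_injective_nat[of v "nat (i + 1)" s] assms by simp
qed

text \<open>The mirror image of \<open>V_U_pow\<close> for a highest weight vector: the term
  containing \<open>U w\<close> is absorbed by \<open>N\<close>.\<close>

lemma U_V_pow:
  assumes "w \<in> G j" "U w \<in> N"
  shows "U ((V ^^ Suc k) w) - scale (of_int ((int k + 1) * (2 * j - D - int k))) ((V ^^ k) w) \<in> N"
proof (induction k)
  case 0
  have "U (V w) - scale (of_int (2 * j - D)) w = V (U w)"
    using commutator[OF assms(1)] by (simp add: algebra_simps)
  then show ?case using V_N[OF assms(2)] by simp
next
  case (Suc k)
  let ?c = "(int k + 1) * (2 * j - D - int k)" and ?d = "2 * (j - int (Suc k)) - D"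
  let ?e = "(int (Suc k) + 1) * (2 * j - D - int (Suc k))"
  have e: "?e = ?c + ?d" by (simp add: algebra_simps)
  have comm: "U ((V ^^ Suc (Suc k)) w) = V (U ((V ^^ Suc k) w)) + scale (of_int ?d) ((V ^^ Suc k) w)"
    using commutator[OF V_pow_G[OF assms(1), of "Suc k"]] by (simp add: diff_eq_eq add.commute)
  have "V (U ((V ^^ Suc k) w)) - scale (of_int ?c) ((V ^^ Suc k) w) \<in> N"
    using V_N[OF Suc] by (simp add: V.diff V.scale)
  then show ?case
    unfolding comm e of_int_add scale_left_distrib add_diff_cancel_right .
qed

text \<open>Iterating \<open>U_V_pow\<close> gives for \<open>c\<close> the product of its
  coefficients. The bounds on \<open>j\<close> and \<open>k\<close> keep all their factors between
  \<open>1\<close> and \<open>D\<close>.\<close>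

lemma U_pow_V_pow:
  assumes w: "w \<in> G j" "U w \<in> N" and "j \<le> D" "int k \<le> 2 * j - D"
  shows "\<exists>c. c \<noteq> 0 \<and> (U ^^ k) ((V ^^ k) w) - scale c w \<in> N"
  using assms(4)
proof (induction k)
  case 0
  show ?case using subspace_0[OF subspace_N] by (intro exI[of _ 1]) simp
next
  case (Suc k)
  then obtain c where c: "c \<noteq> 0" "(U ^^ k) ((V ^^ k) w) - scale c w \<in> N" by auto
  let ?d = "of_int ((int k + 1) * (2 * j - D - int k)) :: 'k"
  have d: "?d \<noteq> 0" by (rule of_int_mult_nonzero) (use Suc.prems assms(3) in auto)
  have "(U ^^ k) (U ((V ^^ Suc k) w)) - scale ?d ((U ^^ k) ((V ^^ k) w)) \<in> N"
    using U_pow_N[OF U_V_pow[OF w, of k], of k] by (simp only: U_pow.diff U_pow.scale)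
  moreover have "scale ?d ((U ^^ k) ((V ^^ k) w)) - scale (?d * c) w \<in> N"
    using subspace_scale[OF subspace_N c(2), of ?d] by (simp add: scale_right_diff_distrib)
  ultimately have "(U ^^ k) (U ((V ^^ Suc k) w)) - scale (?d * c) w \<in> N"
    using subspace_add[OF subspace_N] by fastforce
  then show ?case using c(1) d
    by (intro exI[of _ "?d * c"]) (auto simp: funpow_swap1)
qed

text \<open>Descending induction on the degree \<open>j\<close>, starting above \<open>D\<close>,
  where everything is in \<open>N\<close>. Surjectivity one degree higher corrects \<open>w\<close>
  to a highest weight vector, which \<open>U_pow_V_pow\<close> exhibits as an image under
  \<open>U^s\<close> modulo \<open>N\<close>.\<close>

theorem U_pow_surjective:
  assumes "w \<in> G j" "D + int s \<le> 2 * j"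
  shows "\<exists>u\<in>G (j - int s). w - (U ^^ s) u \<in> N"
  using assms
proof (induction "nat (D + 1 - j)" arbitrary: j w s)
  case 0
  then have "w \<in> N" using G_large[of j] by auto
  then show ?case using subspace_0[OF subspace_G] by (intro bexI[of _ 0]) (simp_all add: U_pow.zero)
next
  case (Suc n)
  then have "j \<le> D" by simp
  obtain u where u: "u \<in> G (j + 1 - int (s + 2))" "U w - (U ^^ (s + 2)) u \<in> N"
    using Suc(1)[of "j + 1" "U w" "s + 2"] Suc.hyps(2) Suc.prems U_G by fastforce
  \<comment> \<open>\<open>U w'\<close> is in \<open>N\<close> by the choice of \<open>u\<close>,
    and the correction \<open>U^(s+1) u = U^s (U u)\<close> is itself in the image of
    \<open>U^s\<close>.\<close>
  define w' where "w' = w - (U ^^ (s + 1)) u"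
  have "U u \<in> G (j - int s)" using U_G[OF u(1)] by simp
  have "(U ^^ (s + 1)) u \<in> G j" using U_pow_G[OF u(1), of "s + 1"] by simp
  then have w': "w' \<in> G j" "U w' \<in> N"
    using u(2) Suc.prems(1) by (auto simp: w'_def U.diff intro: subspace_diff[OF subspace_G])
  obtain c where c: "c \<noteq> 0" "(U ^^ s) ((V ^^ s) w') - scale c w' \<in> N"
    using U_pow_V_pow[OF w' \<open>j \<le> D\<close>, of s] Suc.prems(2) by auto
  define u' where "u' = scale (inverse c) ((V ^^ s) w')"
  have "u' \<in> G (j - int s)"
    unfolding u'_def using V_pow_G[OF w'(1)] by (intro subspace_scale[OF subspace_G])
  moreover have "w' - (U ^^ s) u' \<in> N"
    using subspace_scale[OF subspace_N c(2), of "- inverse c"] c(1)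
    by (simp add: u'_def U_pow.scale scale_right_diff_distrib)
  ultimately show ?case
    using \<open>U u \<in> G (j - int s)\<close>
    by (intro bexI[of _ "U u + u'"] subspace_add[OF subspace_G])
      (simp_all add: w'_def U_pow.add funpow_swap1 algebra_simps)
qed

end

section \<open>Monomial complete intersections\<close>

lemma lookup_single_times:
  fixes t :: "'a :: cancel_comm_monoid_add" and c :: "'b::comm_semiring_0"
  shows "Poly_Mapping.lookup (Poly_Mapping.single t c * p) (t + m) = c * Poly_Mapping.lookup p m"
  by (simp add: lookup_mult lookup_single when_mult Sum_any_when_equal)

definition smult :: "'k::field \<Rightarrow> ('v, 'k) mpoly \<Rightarrow> ('v, 'k) mpoly" where
  "smult c p = Poly_Mapping.single 0 c * p"

lemma lookup_smult [simp]: "Poly_Mapping.lookup (smult c p) m = c * Poly_Mapping.lookup p m"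
  using lookup_single_times[of 0 c p m] by (simp add: smult_def)

interpretation mpoly: vector_space smult
  by unfold_locales (auto intro!: poly_mapping_eqI simp: lookup_add algebra_simps)

section \<open>Coefficients, monomial spans and division by a variable\<close>

lemma lookup_var_times:
  "Poly_Mapping.lookup (var v * p) m = (if Poly_Mapping.lookup m v = 0 then 0
     else Poly_Mapping.lookup p (m - Poly_Mapping.single v 1))"
proof (cases "Poly_Mapping.lookup m v = 0")
  case True
  have "m \<notin> Poly_Mapping.keys (var v * p)"
  proof
    assume "m \<in> Poly_Mapping.keys (var v * p)"
    then obtain b where "m = Poly_Mapping.single v 1 + b"
      using keys_mult[of "var v" p] by (auto simp: var_def)
    then show False using True by (simp add: lookup_add)
  qed
  then show ?thesis using True by (simp add: in_keys_iff)
next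
  case False
  then have "m = Poly_Mapping.single v 1 + (m - Poly_Mapping.single v 1)"
    by (intro poly_mapping_eqI) (auto simp: lookup_add lookup_minus lookup_single when_def)
  then show ?thesis
    using False lookup_single_times[of "Poly_Mapping.single v 1" 1 p "m - Poly_Mapping.single v 1"]
    by (simp add: var_def)
qed

text \<open>The graded parts, the ideals of pure powers and the whisker ideal are all of this form,
  so membership reduces to the vanishing of coefficients.\<close>

definition monomial_span :: "('v \<Rightarrow>\<^sub>0 nat) set \<Rightarrow> ('v, 'k::field) mpoly set" where
  "monomial_span S = {p. Poly_Mapping.keys p \<subseteq> S}"

lemma monomial_spanI:
  "(\<And>m. m \<notin> S \<Longrightarrow> Poly_Mapping.lookup p m = 0) \<Longrightarrow> p \<in> monomial_span S"
  by (auto simp: monomial_span_def in_keys_iff)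

lemma monomial_spanD: "p \<in> monomial_span S \<Longrightarrow> m \<notin> S \<Longrightarrow> Poly_Mapping.lookup p m = 0"
  by (auto simp: monomial_span_def in_keys_iff)

lemma subspace_monomial_span: "mpoly.subspace (monomial_span S)"
  by (rule mpoly.subspaceI)
    (auto intro!: monomial_spanI simp: monomial_spanD lookup_add)

lemma monomial_span_mono: "S \<subseteq> T \<Longrightarrow> monomial_span S \<subseteq> monomial_span T"
  by (auto simp: monomial_span_def)

lemma times_monomial_span:
  assumes "p \<in> monomial_span S" "\<And>m n. m \<in> S \<Longrightarrow> n + m \<in> S"
  shows "q * p \<in> monomial_span S"
  using keys_mult[of q p] assms unfolding monomial_span_def by force

text \<open>The quotient in the division by \<open>var v\<close> with remainder: terms free of
  \<open>var v\<close> are dropped, which makes the map total and linear.\<close>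

definition var_quotient :: "'v \<Rightarrow> ('v, 'k::field) mpoly \<Rightarrow> ('v, 'k) mpoly" where
  "var_quotient v p = Poly_Mapping.map_key (\<lambda>m. m + Poly_Mapping.single v 1) p"

lemma lookup_var_quotient [simp]:
  "Poly_Mapping.lookup (var_quotient v p) m = Poly_Mapping.lookup p (m + Poly_Mapping.single v 1)"
  by (subst var_quotient_def, subst map_key.rep_eq) (auto simp: inj_def)

text \<open>
  The operator \<open>z\<^sup>m \<mapsto> m\<^sub>v (e\<^sub>v - m\<^sub>v) z\<^sup>m / z\<^sub>v\<close>, read off at the monomial \<open>z\<^sup>m / z\<^sub>v\<close>. The commutator
  relation holds in the polynomial ring itself, before passing to the quotient.
\<close>

definition lowering_coeff :: "('v \<Rightarrow> nat) \<Rightarrow> 'v \<Rightarrow> ('v \<Rightarrow>\<^sub>0 nat) \<Rightarrow> int" where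
  "lowering_coeff e v m =
    (int (Poly_Mapping.lookup m v) + 1) * (int (e v) - int (Poly_Mapping.lookup m v) - 1)"

definition lowering :: "('v \<Rightarrow> nat) \<Rightarrow> 'v \<Rightarrow> ('v, 'k::field) mpoly \<Rightarrow> ('v, 'k) mpoly" where
  "lowering e v p =
    Poly_Mapping.mapp (\<lambda>m c. of_int (lowering_coeff e v m) * c) (var_quotient v p)"

lemma lookup_lowering:
  "Poly_Mapping.lookup (lowering e v p) m =
    of_int (lowering_coeff e v m) * Poly_Mapping.lookup p (m + Poly_Mapping.single v 1)"
  by (simp add: lowering_def lookup_mapp when_def in_keys_iff)

text \<open>Operators for different variables commute. For \<open>v = w\<close>, with
  \<open>a\<close> the exponent of \<open>v\<close> in \<open>m\<close>, the coefficient is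
  \<open>a * (e v - a) - (a + 1) * (e v - a - 1) = 2 * a + 1 - e v\<close>.\<close>

lemma commutator_var_lowering:
  "Poly_Mapping.lookup (var v * lowering e w p) m - Poly_Mapping.lookup (lowering e w (var v * p)) m =
    (if v = w then of_int (2 * int (Poly_Mapping.lookup m v) + 1 - int (e v)) * Poly_Mapping.lookup p m
     else 0)"
proof (cases "Poly_Mapping.lookup m v = 0")
  case True
  then show ?thesis
    by (cases "v = w") (auto simp: lookup_var_times lookup_lowering lookup_add lookup_single when_def
        lowering_coeff_def left_diff_distrib)
next
  case False
  define n where "n = m - Poly_Mapping.single v 1"
  then have m: "m = n + Poly_Mapping.single v 1"
    using False
    by (intro poly_mapping_eqI) (auto simp: lookup_add lookup_minus lookup_single when_def)
  have "n + Poly_Mapping.single v (Suc 0) + Poly_Mapping.single w (Suc 0) - Poly_Mapping.single v (Suc 0)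
      = n + Poly_Mapping.single w (Suc 0)"
    by (intro poly_mapping_eqI) (simp add: lookup_add lookup_minus)
  then show ?thesis
    by (cases "v = w") (auto simp: m lookup_var_times lookup_lowering lookup_add lookup_single when_def
        lowering_coeff_def ring_distribs)
qed

section \<open>Degrees and homogeneous parts\<close>

lemma mon_degree_add_var [simp]:
  "mon_degree (m + Poly_Mapping.single (v :: 'v::finite) 1) = mon_degree m + 1"
  and mon_degree_eq_sum: "mon_degree (m :: 'v::finite \<Rightarrow>\<^sub>0 nat) = (\<Sum>v\<in>UNIV. Poly_Mapping.lookup m v)"
proof -
  have eq: "mon_degree m = (\<Sum>v\<in>UNIV. Poly_Mapping.lookup m v)" for m :: "'v \<Rightarrow>\<^sub>0 nat"
    unfolding mon_degree_def by (rule sum.mono_neutral_left) (auto simp: in_keys_iff)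
  then show "mon_degree m = (\<Sum>v\<in>UNIV. Poly_Mapping.lookup m v)" .
  show "mon_degree (m + Poly_Mapping.single v 1) = mon_degree m + 1"
    by (simp add: eq lookup_add sum.distrib lookup_single when_def)
qed

text \<open>Integer degrees, so that the component below degree \<open>0\<close> is \<open>0\<close>.\<close>

definition graded_part :: "int \<Rightarrow> ('v, 'k::field) mpoly set" where
  "graded_part i = monomial_span {m. int (mon_degree m) = i}"

lemma homogeneous_eq: "homogeneous i = graded_part (int i)"
  by (auto simp: homogeneous_def graded_part_def monomial_span_def)

lemma graded_part_neg: "i < 0 \<Longrightarrow> graded_part i = {0}"
  by (auto simp: graded_part_def monomial_span_def)

definition linear_form :: "('v::finite, 'k::field) mpoly" where
  "linear_form = (\<Sum>v\<in>UNIV. var v)"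

lemma lookup_linear_form_times:
  "Poly_Mapping.lookup (linear_form * p) m = (\<Sum>v\<in>UNIV. Poly_Mapping.lookup (var v * p) m)"
  by (simp add: linear_form_def sum_distrib_right lookup_sum)

lemma var_times_graded_part:
  fixes p :: "('v::finite, 'k::field) mpoly"
  assumes "p \<in> graded_part i"
  shows "var v * p \<in> graded_part (i + 1)"
  unfolding graded_part_def
proof (rule monomial_spanI, simp add: lookup_var_times, intro impI)
  fix m :: "'v \<Rightarrow>\<^sub>0 nat"
  assume m: "int (mon_degree m) \<noteq> i + 1" "0 < Poly_Mapping.lookup m v"
  then have "m = (m - Poly_Mapping.single v 1) + Poly_Mapping.single v 1"
    by (intro poly_mapping_eqI) (auto simp: lookup_add lookup_minus lookup_single when_def)
  then have "mon_degree m = mon_degree (m - Poly_Mapping.single v 1) + 1"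
    by (metis mon_degree_add_var)
  then have "int (mon_degree (m - Poly_Mapping.single v 1)) \<noteq> i" using m by auto
  then show "Poly_Mapping.lookup p (m - Poly_Mapping.single v (Suc 0)) = 0"
    using assms by (simp add: graded_part_def monomial_spanD)
qed

lemma linear_form_times_graded_part:
  "p \<in> graded_part i \<Longrightarrow> linear_form * p \<in> graded_part (i + 1)"
  unfolding linear_form_def sum_distrib_right
  by (rule mpoly.subspace_sum[OF subspace_monomial_span[where S = "{m. int (mon_degree m) = i + 1}", folded graded_part_def]])
    (rule var_times_graded_part)

lemma linear_form_graded_part: "linear_form \<in> graded_part 1"
  by (rule linear_form_times_graded_part[of 1 0, simplified])
    (simp add: graded_part_def monomial_span_def mon_degree_def)

lemma linear_form_power_graded_part:
  "p \<in> graded_part i \<Longrightarrow> linear_form ^ s * p \<in> graded_part (i + int s)"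
proof (induction s)
  case (Suc s)
  then show ?case
    using linear_form_times_graded_part[of "linear_form ^ s * p" "i + int s"]
    by (simp add: algebra_simps)
qed simp

lemma var_quotient_graded_part:
  fixes p :: "('v::finite, 'k::field) mpoly"
  assumes "p \<in> graded_part i"
  shows "var_quotient v p \<in> graded_part (i - 1)"
  using assms unfolding graded_part_def
  by (intro monomial_spanI) (auto intro!: monomial_spanD[OF assms[unfolded graded_part_def]] simp: mon_degree_add_var[simplified])

text \<open>The ideal generated by the powers \<open>var v ^ e v\<close>; the value
  \<open>e v = 0\<close> is allowed and makes it the whole ring.\<close>

definition box_ideal :: "('v \<Rightarrow> nat) \<Rightarrow> ('v, 'k::field) mpoly set" where
  "box_ideal e = monomial_span {m. \<exists>v. e v \<le> Poly_Mapping.lookup m v}"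

lemma box_ideal_times: "p \<in> box_ideal e \<Longrightarrow> q * p \<in> box_ideal e"
  unfolding box_ideal_def
  by (rule times_monomial_span) (auto simp: lookup_add intro: trans_le_add2)

lemma subspace_box: "mpoly.subspace (box_ideal e)"
  unfolding box_ideal_def by (rule subspace_monomial_span)

lemma var_times_box: "e v \<le> 1 \<Longrightarrow> var v * p \<in> box_ideal e"
  unfolding box_ideal_def
proof (rule monomial_spanI)
  fix m assume "e v \<le> 1" and m: "m \<notin> {m. \<exists>v. e v \<le> Poly_Mapping.lookup m v}"
  moreover have "Poly_Mapping.lookup m v < e v" using m by (auto simp: not_le)
  ultimately show "Poly_Mapping.lookup (var v * p) m = 0" by (simp add: lookup_var_times)
qed

section \<open>The Lefschetz pair of a monomial complete intersection\<close>

lemma linear_form_power: "((\<lambda>p. linear_form * p) ^^ s) p = linear_form ^ s * p"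
  by (induction s) (simp_all add: mult.assoc)

text \<open>Both operators are sums of one-variable operators, so by
  \<open>commutator_var_lowering\<close> the commutator multiplies a monomial \<open>m\<close> by
  the sum of all \<open>2 * m_v + 1 - e v\<close>, which is \<open>2 * deg m - D\<close>.\<close>

lemma lefschetz_pair_box:
  fixes e :: "'v::finite \<Rightarrow> nat"
  defines "D \<equiv> \<Sum>v\<in>UNIV. int (e v) - 1"
  assumes char: "\<And>k. 0 < k \<Longrightarrow> k \<le> D \<Longrightarrow> of_int k \<noteq> (0 :: 'k::field)"
  shows "lefschetz_pair smult (\<lambda>p. linear_form * p) (\<lambda>p. \<Sum>v\<in>UNIV. lowering e v p)
    graded_part (box_ideal e :: ('v, 'k) mpoly set) D"
proof (intro lefschetz_pair.intro mpoly.vector_space_axioms lefschetz_pair_axioms.intro)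
  show "Vector_Spaces.linear smult smult (\<lambda>p :: ('v, 'k) mpoly. linear_form * p)"
    by unfold_locales (simp_all add: algebra_simps smult_def)
  show "Vector_Spaces.linear smult smult (\<lambda>p :: ('v, 'k) mpoly. \<Sum>v\<in>UNIV. lowering e v p)"
    by unfold_locales
      (auto intro!: poly_mapping_eqI
        simp: lookup_sum lookup_lowering lookup_add algebra_simps sum.distrib sum_distrib_left)
  show "mpoly.subspace (graded_part i :: ('v, 'k) mpoly set)" for i
    unfolding graded_part_def by (rule subspace_monomial_span)
  show "mpoly.subspace (box_ideal e :: ('v, 'k) mpoly set)"
    unfolding box_ideal_def by (rule subspace_monomial_span)
  show "linear_form * p \<in> graded_part (i + 1)" if "p \<in> graded_part i" for i and p :: "('v, 'k) mpoly"
    using that by (rule linear_form_times_graded_part)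
  show "(\<Sum>v\<in>UNIV. lowering e v p) \<in> graded_part (i - 1)"
    if "p \<in> graded_part i" for i and p :: "('v, 'k) mpoly"
  proof -
    have "Poly_Mapping.lookup p (m + Poly_Mapping.single v 1) = 0" if "int (mon_degree m) \<noteq> i - 1" for m v
      using \<open>p \<in> graded_part i\<close> that
      by (intro monomial_spanD[of p]) (auto simp: graded_part_def mon_degree_add_var[simplified])
    then show ?thesis
      unfolding graded_part_def by (intro monomial_spanI) (simp add: lookup_sum lookup_lowering)
  qed
  show "graded_part i \<subseteq> {0 :: ('v, 'k) mpoly}" if "i < 0" for i
    by (simp add: graded_part_neg that)
  show "graded_part i \<subseteq> (box_ideal e :: ('v, 'k) mpoly set)" if "D < i" for i
    unfolding graded_part_def box_ideal_def
  proof (rule monomial_span_mono, safe, rule ccontr)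
    fix m :: "'v \<Rightarrow>\<^sub>0 nat"
    assume "\<nexists>v. e v \<le> Poly_Mapping.lookup m v" and i: "i = int (mon_degree m)"
    then have "int (Poly_Mapping.lookup m v) \<le> int (e v) - 1" for v
      by (metis int_ops(6) leI nat_less_as_int not_le zle_diff1_eq)
    then have "int (mon_degree m) \<le> D"
      unfolding D_def mon_degree_eq_sum of_nat_sum by (intro sum_mono)
    then show False using that i by simp
  qed
  show "linear_form * p \<in> box_ideal e" if "p \<in> box_ideal e" for p :: "('v, 'k) mpoly"
    using that by (rule box_ideal_times)
  show "(\<Sum>v\<in>UNIV. lowering e v p) \<in> box_ideal e" if p: "p \<in> box_ideal e" for p :: "('v, 'k) mpoly"
    unfolding box_ideal_def
  proof (rule monomial_spanI, unfold lookup_sum, rule sum.neutral, rule ballI)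
    fix m v assume m: "m \<notin> {m. \<exists>v. e v \<le> Poly_Mapping.lookup m v}"
    show "Poly_Mapping.lookup (lowering e v p) m = 0"
    \<comment> \<open>Lowering could leave the ideal only from exponent \<open>e v\<close> to
      \<open>e v - 1\<close>, and there the factor \<open>e v - m_v - 1\<close> of the coefficient
      is zero.\<close>
    proof (cases "Poly_Mapping.lookup m v + 1 = e v")
      case True
      then show ?thesis by (simp add: lookup_lowering lowering_coeff_def flip: True)
    next
      case False
      moreover have "Poly_Mapping.lookup m v < e v" using m by (auto simp: not_le)
      ultimately have "Poly_Mapping.lookup m v + 1 < e v" by simp
      then have "m + Poly_Mapping.single v 1 \<notin> {m. \<exists>v. e v \<le> Poly_Mapping.lookup m v}"
        using m by (auto simp: lookup_add lookup_single when_def not_le)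
      then show ?thesis
        using p by (simp add: lookup_lowering box_ideal_def monomial_spanD)
    qed
  qed
  show "linear_form * (\<Sum>v\<in>UNIV. lowering e v p) - (\<Sum>v\<in>UNIV. lowering e v (linear_form * p)) =
      smult (of_int (2 * i - D)) p" if p: "p \<in> graded_part i" for i and p :: "('v, 'k) mpoly"
  proof (rule poly_mapping_eqI)
    fix m
    have "Poly_Mapping.lookup (linear_form * (\<Sum>v\<in>UNIV. lowering e v p) -
        (\<Sum>v\<in>UNIV. lowering e v (linear_form * p))) m =
      (\<Sum>v\<in>UNIV. \<Sum>w\<in>UNIV. Poly_Mapping.lookup (var v * lowering e w p) m) -
      (\<Sum>w\<in>UNIV. \<Sum>v\<in>UNIV. Poly_Mapping.lookup (lowering e w (var v * p)) m)"
      by (simp add: lookup_minus lookup_linear_form_times sum_distrib_left lookup_sum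
          lookup_lowering) (rule sum.swap)
    also have "\<dots> = (\<Sum>v\<in>UNIV. \<Sum>w\<in>UNIV. if v = w then
        of_int (2 * int (Poly_Mapping.lookup m v) + 1 - int (e v)) * Poly_Mapping.lookup p m else 0)"
      by (subst (2) sum.swap) (simp only: commutator_var_lowering flip: sum_subtractf)
    also have "\<dots> = of_int (2 * int (mon_degree m) - D) * Poly_Mapping.lookup p m"
      by (simp add: D_def mon_degree_eq_sum sum_distrib_left sum_distrib_right sum_subtractf sum.distrib algebra_simps)
    also have "\<dots> = Poly_Mapping.lookup (smult (of_int (2 * i - D)) p) m"
      using p by (cases "int (mon_degree m) = i") (simp_all add: graded_part_def monomial_spanD)
    finally show "Poly_Mapping.lookup (linear_form * (\<Sum>v\<in>UNIV. lowering e v p) -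
        (\<Sum>v\<in>UNIV. lowering e v (linear_form * p))) m =
      Poly_Mapping.lookup (smult (of_int (2 * i - D)) p) m" .
  qed
qed (rule char)

lemma box_injective:
  fixes e :: "'v::finite \<Rightarrow> nat" and p :: "('v, 'k::field) mpoly"
  assumes "\<And>k. 0 < k \<Longrightarrow> k \<le> (\<Sum>v\<in>UNIV. int (e v) - 1) \<Longrightarrow> of_int k \<noteq> (0 :: 'k)"
    and "p \<in> graded_part i" "linear_form ^ s * p \<in> box_ideal e"
    and "2 * i + int s \<le> (\<Sum>v\<in>UNIV. int (e v) - 1)"
  shows "p \<in> box_ideal e"
  using lefschetz_pair.U_pow_injective[OF lefschetz_pair_box[OF assms(1)]] assms(2-4)
  by (simp add: linear_form_power)

lemma box_surjective:
  fixes e :: "'v::finite \<Rightarrow> nat" and q :: "('v, 'k::field) mpoly"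
  assumes "\<And>k. 0 < k \<Longrightarrow> k \<le> (\<Sum>v\<in>UNIV. int (e v) - 1) \<Longrightarrow> of_int k \<noteq> (0 :: 'k)"
    and "q \<in> graded_part j" "(\<Sum>v\<in>UNIV. int (e v) - 1) + int s \<le> 2 * j"
  shows "\<exists>p\<in>graded_part (j - int s). q - linear_form ^ s * p \<in> box_ideal e"
  using lefschetz_pair.U_pow_surjective[OF lefschetz_pair_box[OF assms(1)]] assms(2,3)
  by (simp add: linear_form_power)

section \<open>The whiskered complete graph\<close>

lemma poly_ring_simps [simp]:
  "carrier poly_ring = UNIV" "x \<otimes>\<^bsub>poly_ring\<^esub> y = x * y" "x \<oplus>\<^bsub>poly_ring\<^esub> y = x + y"
  "\<one>\<^bsub>poly_ring\<^esub> = 1" "\<zero>\<^bsub>poly_ring\<^esub> = 0"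
  by (simp_all add: ring_of_type_algebra_def)

lemma poly_ring_pow [simp]: "x [^]\<^bsub>poly_ring\<^esub> (n :: nat) = x ^ n"
  by (induction n) (simp_all add: nat_pow_def mult.commute)

interpretation poly_ring: cring "poly_ring :: ('v, 'k::field) mpoly ring"
  by (rule cring_from_type_algebra)

lemma poly_ring_a_minus [simp]: "\<ominus>\<^bsub>poly_ring\<^esub> x = - (x :: ('v, 'k::field) mpoly)"
  by (rule poly_ring.minus_equality) simp_all

lemma subset_set_add_left: "\<zero>\<^bsub>poly_ring\<^esub> \<in> B \<Longrightarrow> A \<subseteq> A <+>\<^bsub>poly_ring\<^esub> B"
  and subset_set_add_right: "\<zero>\<^bsub>poly_ring\<^esub> \<in> A \<Longrightarrow> B \<subseteq> A <+>\<^bsub>poly_ring\<^esub> B"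
  for A B :: "('v, 'k::field) mpoly set"
  by (force simp: set_add_def')+

lemma ideal_monomial_span:
  assumes "\<And>m n. m \<in> S \<Longrightarrow> n + m \<in> S"
  shows "ideal (monomial_span S :: ('v, 'k::field) mpoly set) poly_ring"
proof (rule idealI)
  show "ring (poly_ring :: ('v, 'k) mpoly ring)" by (rule poly_ring.ring_axioms)
  show "subgroup (monomial_span S :: ('v, 'k) mpoly set) (add_monoid poly_ring)"
  proof
    show "inv\<^bsub>add_monoid poly_ring\<^esub> x \<in> monomial_span S"
      if "x \<in> monomial_span S" for x :: "('v, 'k) mpoly"
      unfolding a_inv_def[symmetric] poly_ring_a_minus
      by (rule mpoly.subspace_neg[OF subspace_monomial_span that])
  qed (auto intro: mpoly.subspace_add[OF subspace_monomial_span] mpoly.subspace_0[OF subspace_monomial_span])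
  show "x \<otimes>\<^bsub>poly_ring\<^esub> a \<in> monomial_span S"
    and "a \<otimes>\<^bsub>poly_ring\<^esub> x \<in> monomial_span S"
    if "a \<in> monomial_span S" for a x :: "('v, 'k) mpoly"
    using times_monomial_span[OF that assms, of x] by (simp_all add: mult.commute)
qed

text \<open>A polynomial is the finite sum of its terms, and an ideal absorbs coefficients as
  constant polynomials.\<close>

lemma monomial_span_subset_ideal:
  assumes J: "ideal J (poly_ring :: ('v, 'k::field) mpoly ring)"
    and mono: "\<And>m. m \<in> S \<Longrightarrow> Poly_Mapping.single m 1 \<in> J"
  shows "monomial_span S \<subseteq> J"
proof
  fix p :: "('v, 'k) mpoly" assume p: "p \<in> monomial_span S"
  interpret J: ideal J poly_ring by (rule J)
  have single_mem: "Poly_Mapping.single m c \<in> J" if "m \<in> S" for m c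
    using J.I_l_closed[OF mono[OF that], of "Poly_Mapping.single 0 c"] by (simp add: mult_single)
  have "(\<Sum>m\<in>F. Poly_Mapping.single m (Poly_Mapping.lookup p m)) \<in> J" if "finite F" "F \<subseteq> S" for F
    using that
  proof (induction F rule: finite_induct)
    case empty
    then show ?case using J.zero_closed by simp
  next
    case (insert m F)
    then show ?case using J.a_closed single_mem by fastforce
  qed
  moreover have "p = (\<Sum>m\<in>Poly_Mapping.keys p. Poly_Mapping.single m (Poly_Mapping.lookup p m))"
    by (intro poly_mapping_eqI) (auto simp: lookup_sum lookup_single when_def in_keys_iff)
  ultimately show "p \<in> J" using p by (metis finite_keys monomial_span_def mem_Collect_eq)
qed

lemma ideal_monomial_multiple:
  assumes J: "ideal J (poly_ring :: ('v, 'k::field) mpoly ring)"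
    and "Poly_Mapping.single g 1 \<in> J"
    and "\<And>v. Poly_Mapping.lookup g v \<le> Poly_Mapping.lookup m v"
  shows "Poly_Mapping.single m 1 \<in> J"
proof -
  interpret J: ideal J poly_ring by (rule J)
  have "m = (m - g) + g"
    using assms(3) by (intro poly_mapping_eqI) (simp add: lookup_add lookup_minus)
  then show ?thesis
    using J.I_l_closed[OF assms(2), of "Poly_Mapping.single (m - g) 1"]
    by (simp add: mult_single)
qed

section \<open>The whisker ideal as a monomial ideal\<close>

lemma var_power: "var v ^ k = Poly_Mapping.single (Poly_Mapping.single v k) 1"
  by (induction k) (simp_all add: var_def mult_single flip: single_add)

lemma var_times_var:
  "var v * var w = Poly_Mapping.single (Poly_Mapping.single v 1 + Poly_Mapping.single w 1) 1"
  by (simp add: var_def mult_single)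

text \<open>The monomials divisible by a generator: the three lines belong to
  \<open>x_i x_j\<close>, to \<open>x_i y_i\<close> and to the pure powers.\<close>

definition whisker_monomials :: "('v \<Rightarrow> nat) \<Rightarrow> ('v + 'v \<Rightarrow>\<^sub>0 nat) set" where
  "whisker_monomials d = {m.
     (\<exists>i j. i \<noteq> j \<and> 0 < Poly_Mapping.lookup m (Inl i) \<and> 0 < Poly_Mapping.lookup m (Inl j)) \<or>
     (\<exists>i. 0 < Poly_Mapping.lookup m (Inl i) \<and> 0 < Poly_Mapping.lookup m (Inr i)) \<or>
     (\<exists>i. d i \<le> Poly_Mapping.lookup m (Inl i) \<or> d i \<le> Poly_Mapping.lookup m (Inr i))}"

lemma not_whisker_monomials:
  "m \<notin> whisker_monomials d \<longleftrightarrow>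
    (\<forall>i j. i \<noteq> j \<longrightarrow> 0 < Poly_Mapping.lookup m (Inl i) \<longrightarrow> Poly_Mapping.lookup m (Inl j) = 0) \<and>
    (\<forall>i. 0 < Poly_Mapping.lookup m (Inl i) \<longrightarrow> Poly_Mapping.lookup m (Inr i) = 0) \<and>
    (\<forall>i. Poly_Mapping.lookup m (Inl i) < d i \<and> Poly_Mapping.lookup m (Inr i) < d i)"
  unfolding whisker_monomials_def neq0_conv[symmetric] not_le[symmetric] by blast

lemma whisker_monomials_add:
  assumes "m \<in> whisker_monomials d"
  shows "n + m \<in> whisker_monomials d"
proof -
  have "Poly_Mapping.lookup m v \<le> Poly_Mapping.lookup (n + m) v" for v by (simp add: lookup_add)
  then show ?thesis
    using assms unfolding whisker_monomials_def mem_Collect_eq by (meson less_le_trans order.trans)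
qed

lemma mem_complete_graph: "{i, j} \<in> complete_graph \<longleftrightarrow> i \<noteq> j"
  by (auto simp: complete_graph_def doubleton_eq_iff)

lemma single_mem_monomial_span: "m \<in> S \<Longrightarrow> Poly_Mapping.single m c \<in> monomial_span S"
  by (simp add: monomial_span_def)

text \<open>All generators are monomials, and a monomial ideal is spanned by the monomial multiples
  of its generators. One inclusion is minimality of generated ideals, the other is checked on single
  monomials.\<close>

theorem whisker_ideal_complete_graph:
  "whisker_ideal complete_graph d =
    (monomial_span (whisker_monomials d) :: ('v + 'v, 'k::field) mpoly set)"
proof
  let ?M = "monomial_span (whisker_monomials d) :: ('v + 'v, 'k) mpoly set"
  let ?E = "{var i * var j |i j. {i, j} \<in> whisker complete_graph} :: ('v + 'v, 'k) mpoly set"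
  let ?P = "{var (Inl i) ^ d i |i. True} \<union> {var (Inr i) ^ d i |i. True} :: ('v + 'v, 'k) mpoly set"
  have M: "ideal ?M poly_ring" by (rule ideal_monomial_span) (rule whisker_monomials_add)
  interpret M: ideal ?M poly_ring by (rule M)
  have xx: "(var (Inl i) * var (Inl j) :: ('v + 'v, 'k) mpoly) \<in> ?M" if "i \<noteq> j" for i j
    unfolding var_times_var
  proof (rule single_mem_monomial_span, unfold whisker_monomials_def, intro CollectI disjI1 exI conjI)
    show "i \<noteq> j" by fact
  qed (simp_all add: lookup_add)
  have xy: "(var (Inl i) * var (Inr i) :: ('v + 'v, 'k) mpoly) \<in> ?M" for i
    unfolding var_times_var
    by (rule single_mem_monomial_span, unfold whisker_monomials_def,
        intro CollectI disjI2 disjI1 exI[of _ i]) (simp add: lookup_add)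
  have E: "?E \<subseteq> ?M"
  proof safe
    fix v w :: "'v + 'v" assume "{v, w} \<in> whisker complete_graph"
    then consider i j where "{v, w} = {Inl i, Inl j}" "i \<noteq> j" | i where "{v, w} = {Inl i, Inr i}"
      unfolding whisker_def mem_complete_graph by blast
    then show "var v * var w \<in> ?M"
    proof cases
      case (1 i j)
      then show ?thesis using xx[of i j] by (auto simp: doubleton_eq_iff mult.commute)
    next
      case (2 i)
      then show ?thesis using xy[of i] by (auto simp: doubleton_eq_iff mult.commute)
    qed
  qed
  have P: "?P \<subseteq> ?M"
  proof safe
    fix i
    show "(var (Inl i) ^ d i :: ('v + 'v, 'k) mpoly) \<in> ?M"
      unfolding var_power
      by (rule single_mem_monomial_span, unfold whisker_monomials_def,
          intro CollectI disjI2, rule exI[of _ i]) simp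
    show "(var (Inr i) ^ d i :: ('v + 'v, 'k) mpoly) \<in> ?M"
      unfolding var_power
      by (rule single_mem_monomial_span, unfold whisker_monomials_def,
          intro CollectI disjI2, rule exI[of _ i]) simp
  qed
  have "edge_ideal (whisker complete_graph) \<subseteq> ?M"
    unfolding edge_ideal_def by (rule poly_ring.genideal_minimal[OF M E])
  moreover have "Idl\<^bsub>poly_ring\<^esub> ?P \<subseteq> ?M" by (rule poly_ring.genideal_minimal[OF M P])
  ultimately show "whisker_ideal complete_graph d \<subseteq> ?M"
    unfolding whisker_ideal_def set_add_def' using M.a_closed by auto
  let ?J = "whisker_ideal complete_graph d :: ('v + 'v, 'k) mpoly set"
  have IE: "ideal (edge_ideal (whisker complete_graph) :: ('v + 'v, 'k) mpoly set) poly_ring"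
    unfolding edge_ideal_def by (rule poly_ring.genideal_ideal) simp
  have IP: "ideal (Idl\<^bsub>poly_ring\<^esub> ?P) poly_ring" by (rule poly_ring.genideal_ideal) simp
  have J: "ideal ?J poly_ring"
    unfolding whisker_ideal_def by (rule poly_ring.add_ideals[OF IE IP])
  have "?E \<subseteq> edge_ideal (whisker complete_graph)"
    unfolding edge_ideal_def by (rule poly_ring.genideal_self) simp
  then have EJ: "?E \<subseteq> ?J"
    unfolding whisker_ideal_def
    using subset_set_add_left[OF additive_subgroup.zero_closed[OF ideal.axioms(1)[OF IP]]] by blast
  have "?P \<subseteq> Idl\<^bsub>poly_ring\<^esub> ?P" by (rule poly_ring.genideal_self) simp
  then have PJ: "?P \<subseteq> ?J"
    unfolding whisker_ideal_def
    using subset_set_add_right[OF additive_subgroup.zero_closed[OF ideal.axioms(1)[OF IE]]] by blast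
  have edge: "Poly_Mapping.single (Poly_Mapping.single v 1 + Poly_Mapping.single w 1) 1 \<in> ?J"
    if "{v, w} \<in> whisker complete_graph" for v w :: "'v + 'v"
    using EJ that unfolding var_times_var[symmetric] by blast
  have power: "Poly_Mapping.single (Poly_Mapping.single (Inl i) (d i)) 1 \<in> ?J"
    "Poly_Mapping.single (Poly_Mapping.single (Inr i) (d i)) 1 \<in> ?J" for i
    using PJ unfolding var_power[symmetric] by blast+
  show "?M \<subseteq> ?J"
  proof (rule monomial_span_subset_ideal[OF J])
    fix m :: "'v + 'v \<Rightarrow>\<^sub>0 nat" assume "m \<in> whisker_monomials d"
    then show "Poly_Mapping.single m 1 \<in> ?J"
      unfolding whisker_monomials_def
    proof (elim CollectE disjE exE conjE)
      fix i j
      assume *: "i \<noteq> j" "0 < Poly_Mapping.lookup m (Inl i)" "0 < Poly_Mapping.lookup m (Inl j)"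
      have "{Inl i, Inl j} \<in> whisker complete_graph"
        unfolding whisker_def using mem_complete_graph[of i j] *(1) by blast
      then show "Poly_Mapping.single m 1 \<in> ?J"
        by (rule ideal_monomial_multiple[OF J edge]) (use * in \<open>auto simp: lookup_add lookup_single when_def\<close>)
    next
      fix i
      assume *: "0 < Poly_Mapping.lookup m (Inl i)" "0 < Poly_Mapping.lookup m (Inr i)"
      have "{Inl i, Inr i} \<in> whisker complete_graph"
        unfolding whisker_def by blast
      then show "Poly_Mapping.single m 1 \<in> ?J"
        by (rule ideal_monomial_multiple[OF J edge]) (use * in \<open>auto simp: lookup_add lookup_single when_def\<close>)
    next
      fix i assume *: "d i \<le> Poly_Mapping.lookup m (Inl i)"
      show "Poly_Mapping.single m 1 \<in> ?J"
        by (rule ideal_monomial_multiple[OF J power(1)]) (use * in \<open>auto simp: lookup_single when_def\<close>)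
    next
      fix i assume *: "d i \<le> Poly_Mapping.lookup m (Inr i)"
      show "Poly_Mapping.single m 1 \<in> ?J"
        by (rule ideal_monomial_multiple[OF J power(2)]) (use * in \<open>auto simp: lookup_single when_def\<close>)
    qed
  qed
qed

section \<open>Division by a variable and the linear form\<close>

lemma var_quotient_add: "var_quotient v (p + q) = var_quotient v p + var_quotient v q"
  and var_quotient_diff: "var_quotient v (p - q) = var_quotient v p - var_quotient v q"
  and var_quotient_sum: "var_quotient v (\<Sum>a\<in>B. f a) = (\<Sum>a\<in>B. var_quotient v (f a))"
  by (intro poly_mapping_eqI; simp add: lookup_add lookup_minus lookup_sum)+

lemma var_quotient_var_times:
  "var_quotient v (var w * p) = (if v = w then p else var w * var_quotient v p)"
proof (rule poly_mapping_eqI)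
  fix m
  have "m + Poly_Mapping.single v (Suc 0) - Poly_Mapping.single w (Suc 0) =
      m - Poly_Mapping.single w (Suc 0) + Poly_Mapping.single v (Suc 0)"
    if "0 < Poly_Mapping.lookup m w"
    using that by (intro poly_mapping_eqI) (auto simp: lookup_add lookup_minus lookup_single when_def)
  then show "Poly_Mapping.lookup (var_quotient v (var w * p)) m =
      Poly_Mapping.lookup (if v = w then p else var w * var_quotient v p) m"
    by (auto simp: lookup_var_times lookup_add lookup_single when_def)
qed

text \<open>Division by \<open>var v\<close> commutes with the other variables. From the summand
  \<open>var v * p\<close> it yields \<open>p\<close> instead of
  \<open>var v * var_quotient v p\<close>; the difference is the part of \<open>p\<close> free of
  \<open>var v\<close>.\<close>

lemma var_quotient_linear_form:
  "var_quotient v (linear_form * p) = linear_form * var_quotient v p + (p - var v * var_quotient v p)"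
proof -
  have "linear_form * q = var v * q + (\<Sum>w\<in>UNIV - {v}. var w * q)" for q :: "('a, 'b) mpoly"
    by (simp add: linear_form_def distrib_right sum_distrib_right sum.remove[of UNIV v])
  moreover have "(\<Sum>w\<in>UNIV - {v}. var_quotient v (var w * p)) = (\<Sum>w\<in>UNIV - {v}. var w * var_quotient v p)"
    by (rule sum.cong) (auto simp: var_quotient_var_times)
  ultimately show ?thesis
    by (simp add: var_quotient_add var_quotient_sum) (simp add: var_quotient_var_times)
qed

text \<open>
  An exponent \<open>1\<close> removes a variable from the quotient by \<open>box_ideal\<close>, so one polynomial ring serves
  all the pieces. If \<open>d i = 1\<close> the exponent of \<open>x\<^sub>i\<close> in \<open>vertex_exponents\<close> is \<open>0\<close>, and that quotient
  is \<open>0\<close>.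
\<close>

definition whisker_exponents :: "('v \<Rightarrow> nat) \<Rightarrow> 'v + 'v \<Rightarrow> nat" where
  "whisker_exponents d = case_sum (\<lambda>_. 1) d"

definition vertex_exponents :: "('v \<Rightarrow> nat) \<Rightarrow> 'v \<Rightarrow> 'v + 'v \<Rightarrow> nat" where
  "vertex_exponents d i = case_sum (\<lambda>j. if j = i then d i - 1 else 1) (\<lambda>j. if j = i then 1 else d j)"

section \<open>Socle degrees and the characteristic\<close>

lemma sum_UNIV_sum:
  "(\<Sum>v\<in>UNIV. f v) = (\<Sum>i\<in>UNIV. f (Inl i)) + (\<Sum>i\<in>UNIV. f (Inr i))"
  for f :: "'a::finite + 'b::finite \<Rightarrow> 'c::comm_monoid_add"
  by (simp add: sum.Plus flip: UNIV_Plus_UNIV)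

lemma sum_whisker_exponents:
  "(\<Sum>v\<in>UNIV. int (whisker_exponents d v) - 1) = (\<Sum>i\<in>UNIV. int (d i) - 1)"
  for d :: "'v::finite \<Rightarrow> nat"
  by (simp add: sum_UNIV_sum whisker_exponents_def)

text \<open>Compared with \<open>whisker_exponents d\<close>, the variable \<open>x_i\<close> gains
  \<open>d i - 2\<close> and \<open>y_i\<close> loses \<open>d i - 1\<close>. Positivity of
  \<open>d i\<close> makes the natural-number subtraction in the exponent \<open>d i - 1\<close>
  exact.\<close>

lemma sum_vertex_exponents:
  fixes d :: "'v::finite \<Rightarrow> nat"
  assumes "d i > 0"
  shows "(\<Sum>v\<in>UNIV. int (vertex_exponents d i v) - 1) = (\<Sum>j\<in>UNIV. int (d j) - 1) - 1"
proof -
  have "(\<Sum>j\<in>UNIV. int (vertex_exponents d i (Inl j)) - 1) = (\<Sum>j\<in>UNIV. if j = i then int (d i) - 2 else 0)"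
    using assms by (intro sum.cong) (auto simp: vertex_exponents_def)
  moreover have "(\<Sum>j\<in>UNIV. int (vertex_exponents d i (Inr j)) - 1) =
      (\<Sum>j\<in>UNIV. (int (d j) - 1) - (if j = i then int (d i) - 1 else 0))"
    by (intro sum.cong) (auto simp: vertex_exponents_def)
  ultimately show ?thesis by (simp add: sum_UNIV_sum sum_subtractf)
qed

lemma of_int_nonzero_CHAR:
  assumes "CHAR('k::field) = 0 \<or> CHAR('k) > D" "0 < k" "k \<le> int D"
  shows "of_int k \<noteq> (0 :: 'k)"
proof
  assume "of_int k = (0 :: 'k)"
  then have "of_nat (nat k) = (0 :: 'k)" using assms(2) by simp
  then have "CHAR('k) dvd nat k" by (simp only: of_nat_eq_0_iff_char_dvd)
  moreover have "nat k \<noteq> 0" "nat k \<le> D" using assms by auto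
  ultimately show False using assms(1) by (auto dest: dvd_imp_le)
qed

section \<open>Decomposition modulo the whisker ideal\<close>

context
  fixes d :: "'n::finite \<Rightarrow> nat"
  assumes d_pos: "\<And>i. d i > 0"
begin

lemma not_box_whisker:
  "\<not> (\<exists>v. whisker_exponents d v \<le> Poly_Mapping.lookup m v) \<longleftrightarrow>
    (\<forall>i. Poly_Mapping.lookup m (Inl i) = 0 \<and> Poly_Mapping.lookup m (Inr i) < d i)"
  by (auto simp: not_le split_sum_all whisker_exponents_def)

text \<open>The right-hand side says that \<open>x_i\<close> times \<open>m\<close> is outside
  \<open>whisker_monomials d\<close>; the form \<open>_ + 1 < d i\<close> avoids truncated
  subtraction.\<close>

lemma not_box_vertex:
  "\<not> (\<exists>v. vertex_exponents d i v \<le> Poly_Mapping.lookup m v) \<longleftrightarrow>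
    Poly_Mapping.lookup m (Inl i) + 1 < d i \<and> Poly_Mapping.lookup m (Inr i) = 0 \<and>
    (\<forall>j. j \<noteq> i \<longrightarrow> Poly_Mapping.lookup m (Inl j) = 0 \<and> Poly_Mapping.lookup m (Inr j) < d j)"
  unfolding not_ex not_le split_sum_all vertex_exponents_def sum.case
  by (auto simp: less_diff_conv all_conj_distrib split: if_splits)

text \<open>A monomial outside \<open>whisker_monomials d\<close> either contains no
  \<open>x_i\<close>, and these are the monomials outside the ideal for
  \<open>whisker_exponents d\<close>, or contains exactly one \<open>x_i\<close> and not
  \<open>y_i\<close>. Dividing the latter by \<open>x_i\<close> gives exactly the monomials outside
  the ideal for \<open>vertex_exponents d i\<close>. So the two conditions test all coefficients
  that have to vanish.\<close>

theorem mem_whisker_ideal_iff: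
  "p \<in> monomial_span (whisker_monomials d) \<longleftrightarrow>
    p \<in> box_ideal (whisker_exponents d) \<and>
    (\<forall>i. var_quotient (Inl i) p \<in> box_ideal (vertex_exponents d i))"
proof safe
  assume p: "p \<in> monomial_span (whisker_monomials d)"
  show "p \<in> box_ideal (whisker_exponents d)"
    unfolding box_ideal_def
  proof (rule monomial_spanI, unfold mem_Collect_eq not_box_whisker)
    fix m assume m: "\<forall>i. Poly_Mapping.lookup m (Inl i) = 0 \<and> Poly_Mapping.lookup m (Inr i) < d i"
    then have "m \<notin> whisker_monomials d"
      using d_pos by (auto simp: whisker_monomials_def not_le)
    then show "Poly_Mapping.lookup p m = 0" using p by (rule monomial_spanD[rotated])
  qed
  show "var_quotient (Inl i) p \<in> box_ideal (vertex_exponents d i)" for i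
    unfolding box_ideal_def
  proof (rule monomial_spanI, unfold mem_Collect_eq not_box_vertex)
    fix m
    assume m: "Poly_Mapping.lookup m (Inl i) + 1 < d i \<and> Poly_Mapping.lookup m (Inr i) = 0 \<and>
      (\<forall>j. j \<noteq> i \<longrightarrow> Poly_Mapping.lookup m (Inl j) = 0 \<and> Poly_Mapping.lookup m (Inr j) < d j)"
    have "Poly_Mapping.lookup (m + Poly_Mapping.single (Inl i) 1) (Inl j) =
        (if j = i then Poly_Mapping.lookup m (Inl i) + 1 else 0)"
      and "Poly_Mapping.lookup (m + Poly_Mapping.single (Inl i) 1) (Inr j) = Poly_Mapping.lookup m (Inr j)" for j
      using m by (auto simp: lookup_add lookup_single when_def)
    then have "m + Poly_Mapping.single (Inl i) 1 \<notin> whisker_monomials d"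
      unfolding not_whisker_monomials using m d_pos by auto
    then show "Poly_Mapping.lookup (var_quotient (Inl i) p) m = 0"
      using p by (simp add: monomial_spanD)
  qed
next
  assume p: "p \<in> box_ideal (whisker_exponents d)"
    "\<forall>i. var_quotient (Inl i) p \<in> box_ideal (vertex_exponents d i)"
  show "p \<in> monomial_span (whisker_monomials d)"
  proof (rule monomial_spanI)
    fix m assume m: "m \<notin> whisker_monomials d"
    show "Poly_Mapping.lookup p m = 0"
    proof (cases "\<exists>i. Poly_Mapping.lookup m (Inl i) > 0")
      case False
      then have "\<forall>i. Poly_Mapping.lookup m (Inl i) = 0 \<and> Poly_Mapping.lookup m (Inr i) < d i"
        using m by (auto simp: whisker_monomials_def not_le)
      then show ?thesis
        using p(1) unfolding box_ideal_def not_box_whisker[symmetric]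
        by (intro monomial_spanD[of p]) auto
    next
      case True
      then obtain i where i: "Poly_Mapping.lookup m (Inl i) > 0" by blast
      have "Poly_Mapping.lookup m (Inl j) = 0" if "j \<noteq> i" for j
        using m i that unfolding not_whisker_monomials by metis
      define n where "n = m - Poly_Mapping.single (Inl i) 1"
      have mn: "m = n + Poly_Mapping.single (Inl i) 1"
        using i by (intro poly_mapping_eqI) (auto simp: n_def lookup_add lookup_minus lookup_single when_def)
      have "Poly_Mapping.lookup n (Inl i) + 1 < d i \<and> Poly_Mapping.lookup n (Inr i) = 0 \<and>
        (\<forall>j. j \<noteq> i \<longrightarrow> Poly_Mapping.lookup n (Inl j) = 0 \<and> Poly_Mapping.lookup n (Inr j) < d j)"
        using m i \<open>\<And>j. j \<noteq> i \<Longrightarrow> Poly_Mapping.lookup m (Inl j) = 0\<close> unfolding not_whisker_monomials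
        by (auto simp: n_def lookup_minus lookup_single when_def)
      then have "Poly_Mapping.lookup (var_quotient (Inl i) p) n = 0"
        using p(2) unfolding box_ideal_def not_box_vertex[symmetric]
        by (intro monomial_spanD[of "var_quotient (Inl i) p"]) auto
      then show ?thesis by (simp add: mn)
    qed
  qed
qed

text \<open>Each step adds as error the part of \<open>linear_form ^ s * p\<close> free of
  \<open>x_i\<close>. As that polynomial is in the ideal for \<open>whisker_exponents d\<close>,
  each monomial of the error contains some \<open>x_j\<close> with \<open>j \<noteq> i\<close> or
  some \<open>y_j ^ d j\<close>, hence is in the ideal for
  \<open>vertex_exponents d i\<close>.\<close>

lemma var_quotient_linear_form_power:
  assumes "p \<in> box_ideal (whisker_exponents d)"
  shows "var_quotient (Inl i) (linear_form ^ s * p) - linear_form ^ s * var_quotient (Inl i) p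
    \<in> box_ideal (vertex_exponents d i)"
proof (induction s)
  case 0
  show ?case by (simp add: mpoly.subspace_0[OF subspace_box])
next
  case (Suc s)
  let ?q = "linear_form ^ s * p"
  have q: "?q \<in> box_ideal (whisker_exponents d)"
    using assms by (rule box_ideal_times)
  have "?q - var (Inl i) * var_quotient (Inl i) ?q \<in> box_ideal (vertex_exponents d i)"
    unfolding box_ideal_def
  proof (rule monomial_spanI, unfold mem_Collect_eq not_box_vertex)
    fix m
    assume m: "Poly_Mapping.lookup m (Inl i) + 1 < d i \<and> Poly_Mapping.lookup m (Inr i) = 0 \<and>
      (\<forall>j. j \<noteq> i \<longrightarrow> Poly_Mapping.lookup m (Inl j) = 0 \<and> Poly_Mapping.lookup m (Inr j) < d j)"
    show "Poly_Mapping.lookup (?q - var (Inl i) * var_quotient (Inl i) ?q) m = 0"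
    proof (cases "Poly_Mapping.lookup m (Inl i) = 0")
      case True
      \<comment> \<open>For \<open>y_i\<close>, whose exponent in \<open>m\<close> is
        \<open>0\<close>, the bound is the positivity of \<open>d i\<close>.\<close>
      have "\<forall>j. Poly_Mapping.lookup m (Inl j) = 0 \<and> Poly_Mapping.lookup m (Inr j) < d j"
        using m True d_pos by metis
      then have "Poly_Mapping.lookup ?q m = 0"
        using q unfolding box_ideal_def not_box_whisker[symmetric]
        by (intro monomial_spanD[of ?q]) auto
      then show ?thesis using True by (simp add: lookup_minus lookup_var_times)
    next
      case False
      then have "m - Poly_Mapping.single (Inl i) 1 + Poly_Mapping.single (Inl i) 1 = m"
        by (intro poly_mapping_eqI) (auto simp: lookup_add lookup_minus lookup_single when_def)
      then show ?thesis using False by (simp add: lookup_minus lookup_var_times)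
    qed
  qed
  moreover have "linear_form * (var_quotient (Inl i) ?q - linear_form ^ s * var_quotient (Inl i) p)
      \<in> box_ideal (vertex_exponents d i)"
    using Suc by (rule box_ideal_times)
  ultimately have "(?q - var (Inl i) * var_quotient (Inl i) ?q) +
      linear_form * (var_quotient (Inl i) ?q - linear_form ^ s * var_quotient (Inl i) p)
      \<in> box_ideal (vertex_exponents d i)"
    by (rule mpoly.subspace_add[OF subspace_box])
  then show ?case
    unfolding power_Suc mult.assoc var_quotient_linear_form by (simp add: algebra_simps)
qed


text \<open>The quotient by all \<open>x_i\<close> comes first: once \<open>p\<close> is in the
  ideal for \<open>whisker_exponents d\<close>, division by \<open>x_i\<close> commutes with powers
  of the linear form modulo the ideal for \<open>vertex_exponents d i\<close>, and injectivity there
  applies.\<close>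

lemma whisker_injective:
  fixes p :: "('n + 'n, 'k::field) mpoly"
  defines "D \<equiv> \<Sum>i\<in>UNIV. int (d i) - 1"
  assumes char: "\<And>k. 0 < k \<Longrightarrow> k \<le> D \<Longrightarrow> of_int k \<noteq> (0 :: 'k)"
    and p: "p \<in> graded_part j" "linear_form ^ s * p \<in> monomial_span (whisker_monomials d)"
    and le: "2 * j + int s \<le> D"
  shows "p \<in> monomial_span (whisker_monomials d)"
proof -
  note iff = mem_whisker_ideal_iff
  have box: "p \<in> box_ideal (whisker_exponents d)"
    by (rule box_injective[OF _ p(1), of _ s])
      (use char p(2) le in \<open>auto simp: iff sum_whisker_exponents D_def\<close>)
  have "var_quotient (Inl i) p \<in> box_ideal (vertex_exponents d i)" for i
  proof (rule box_injective[OF _ var_quotient_graded_part[OF p(1)]])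
    have "var_quotient (Inl i) (linear_form ^ s * p) \<in> box_ideal (vertex_exponents d i)"
      using p(2) by (simp add: iff)
    from mpoly.subspace_diff[OF subspace_box this var_quotient_linear_form_power[OF box, of i s]]
    show "linear_form ^ s * var_quotient (Inl i) p \<in> box_ideal (vertex_exponents d i)" by simp
    \<comment> \<open>The degree and the socle degree both drop by one, so the left side loses
      \<open>2\<close> and the right side only \<open>1\<close>.\<close>
    show "2 * (j - 1) + int s \<le> (\<Sum>v\<in>UNIV. int (vertex_exponents d i v) - 1)"
      using le by (simp add: sum_vertex_exponents d_pos D_def)
    show "of_int k \<noteq> (0 :: 'k)"
      if "0 < k" "k \<le> (\<Sum>v\<in>UNIV. int (vertex_exponents d i v) - 1)" for k
      using that by (intro char) (auto simp: sum_vertex_exponents d_pos D_def)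
  qed
  with box show ?thesis by (simp add: iff)
qed

text \<open>A preimage \<open>p0\<close> modulo all \<open>x_i\<close> leaves a remainder
  \<open>r\<close> in the kernel; preimages \<open>f i\<close> of the quotients of \<open>r\<close>
  by \<open>x_i\<close> are then glued to a correction \<open>u\<close> that is zero modulo all
  \<open>x_i\<close>.\<close>

lemma whisker_surjective:
  fixes q :: "('n + 'n, 'k::field) mpoly"
  defines "D \<equiv> \<Sum>i\<in>UNIV. int (d i) - 1"
  assumes char: "\<And>k. 0 < k \<Longrightarrow> k \<le> D \<Longrightarrow> of_int k \<noteq> (0 :: 'k)"
    and q: "q \<in> graded_part j" and le: "D + int s < 2 * j"
  shows "\<exists>p\<in>graded_part (j - int s). q - linear_form ^ s * p \<in> monomial_span (whisker_monomials d)"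
proof -
  note iff = mem_whisker_ideal_iff
  note subspace_graded = subspace_monomial_span[where S = "{m. int (mon_degree m) = k}" for k, folded graded_part_def]
  have "\<exists>p\<in>graded_part (j - int s). q - linear_form ^ s * p \<in> box_ideal (whisker_exponents d)"
    by (rule box_surjective[OF _ q]) (use char le in \<open>auto simp: sum_whisker_exponents D_def\<close>)
  then obtain p0 where p0: "p0 \<in> graded_part (j - int s)"
    "q - linear_form ^ s * p0 \<in> box_ideal (whisker_exponents d)" by blast
  define r where "r = q - linear_form ^ s * p0"
  have r: "r \<in> graded_part j"
    unfolding r_def
    using mpoly.subspace_diff[OF subspace_graded q linear_form_power_graded_part[OF p0(1), of s, simplified]] .
  have "\<exists>p\<in>graded_part (j - 1 - int s).
      var_quotient (Inl i) r - linear_form ^ s * p \<in> box_ideal (vertex_exponents d i)" for i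
  proof (rule box_surjective[OF _ var_quotient_graded_part[OF r]])
    show "of_int k \<noteq> (0 :: 'k)"
      if "0 < k" "k \<le> (\<Sum>v\<in>UNIV. int (vertex_exponents d i v) - 1)" for k
      using that by (intro char) (auto simp: sum_vertex_exponents d_pos D_def)
    \<comment> \<open>Here the strict inequality enters: \<open>D - 1 + s \<le> 2 * (j - 1)\<close>
      is the same as \<open>D + s < 2 * j\<close>.\<close>
    show "(\<Sum>v\<in>UNIV. int (vertex_exponents d i v) - 1) + int s \<le> 2 * (j - 1)"
      using le by (simp add: sum_vertex_exponents d_pos D_def)
  qed
  then obtain f where f: "\<And>i. f i \<in> graded_part (j - 1 - int s)"
    "\<And>i. var_quotient (Inl i) r - linear_form ^ s * f i \<in> box_ideal (vertex_exponents d i)"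
    by metis
  define u where "u = (\<Sum>i\<in>UNIV. var (Inl i) * f i)"
  have "u \<in> graded_part (j - int s)"
    unfolding u_def
  proof (rule mpoly.subspace_sum[OF subspace_graded])
    show "var (Inl i) * f i \<in> graded_part (j - int s)" for i
      using var_times_graded_part[OF f(1)[of i], of "Inl i"] by (simp add: algebra_simps)
  qed
  then have "p0 + u \<in> graded_part (j - int s)"
    by (rule mpoly.subspace_add[OF subspace_graded p0(1)])
  moreover have u_box: "u \<in> box_ideal (whisker_exponents d)"
    unfolding u_def
    by (rule mpoly.subspace_sum[OF subspace_box]) (rule var_times_box, simp add: whisker_exponents_def)
  \<comment> \<open>Modulo the ideal for \<open>vertex_exponents d k\<close> every other
    \<open>x_i\<close> is zero, so only the summand \<open>x_k * f k\<close> of \<open>u\<close>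
    counts.\<close>
  have "var_quotient (Inl k) u - f k \<in> box_ideal (vertex_exponents d k)" for k
  proof -
    have "var_quotient (Inl k) u =
        (\<Sum>i\<in>UNIV. if k = i then f i else var (Inl i) * var_quotient (Inl k) (f i))"
      by (simp add: u_def var_quotient_sum var_quotient_var_times)
    also have "\<dots> = f k + (\<Sum>i\<in>UNIV - {k}. var (Inl i) * var_quotient (Inl k) (f i))"
      by (subst sum.remove[of UNIV k]) (auto intro!: sum.cong)
    finally have "var_quotient (Inl k) u - f k =
        (\<Sum>i\<in>UNIV - {k}. var (Inl i) * var_quotient (Inl k) (f i))" by simp
    then show ?thesis
      by (simp only:) (rule mpoly.subspace_sum[OF subspace_box], rule var_times_box, auto simp: vertex_exponents_def)
  qed
  then have u_quot: "linear_form ^ s * (var_quotient (Inl k) u - f k) \<in> box_ideal (vertex_exponents d k)" for k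
    by (rule box_ideal_times)
  have "r - linear_form ^ s * u \<in> monomial_span (whisker_monomials d)"
    unfolding iff
  proof (intro conjI allI)
    show "r - linear_form ^ s * u \<in> box_ideal (whisker_exponents d)"
      using p0(2) box_ideal_times[OF u_box] unfolding r_def
      by (rule mpoly.subspace_diff[OF subspace_box])
    fix k
    \<comment> \<open>The three differences are the error of the preimage \<open>f k\<close>, the
      failure of division by \<open>x_k\<close> to commute with \<open>linear_form ^ s\<close>, and
      the contribution of the other summands of \<open>u\<close>.\<close>
    have "var_quotient (Inl k) (r - linear_form ^ s * u) =
      (var_quotient (Inl k) r - linear_form ^ s * f k)
        - (var_quotient (Inl k) (linear_form ^ s * u) - linear_form ^ s * var_quotient (Inl k) u)
        - linear_form ^ s * (var_quotient (Inl k) u - f k)"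
      by (simp add: var_quotient_diff algebra_simps)
    also have "\<dots> \<in> box_ideal (vertex_exponents d k)"
      by (intro mpoly.subspace_diff[OF subspace_box] f(2) u_quot
          var_quotient_linear_form_power[OF u_box])
    finally show "var_quotient (Inl k) (r - linear_form ^ s * u) \<in> box_ideal (vertex_exponents d k)" .
  qed
  then have "q - linear_form ^ s * (p0 + u) \<in> monomial_span (whisker_monomials d)"
    by (simp add: r_def algebra_simps)
  ultimately show ?thesis by blast
qed

end

section \<open>Cosets and the Lefschetz maps of the algebra\<close>

lemma coset_eq_iff:
  assumes "ideal J (poly_ring :: ('v, 'k::field) mpoly ring)"
  shows "J +>\<^bsub>poly_ring\<^esub> p = J +>\<^bsub>poly_ring\<^esub> q \<longleftrightarrow> p - q \<in> J"
  using poly_ring.quotient_eq_iff_same_a_r_cos[OF assms, of p q] by (simp add: a_minus_def)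

lemma coset_pow_mult:
  assumes "ideal J (poly_ring :: ('v, 'k::field) mpoly ring)"
  shows "(J +>\<^bsub>poly_ring\<^esub> l) [^]\<^bsub>poly_ring Quot J\<^esub> (s :: nat) \<otimes>\<^bsub>poly_ring Quot J\<^esub> (J +>\<^bsub>poly_ring\<^esub> p) =
    J +>\<^bsub>poly_ring\<^esub> (l ^ s * p)"
proof -
  interpret J: ideal J poly_ring by (rule assms)
  interpret hom: ring_hom_ring poly_ring "poly_ring Quot J" "(+>\<^bsub>poly_ring\<^esub>) J"
    by (rule J.rcos_ring_hom_ring)
  show ?thesis using hom.hom_nat_pow[of l s] hom.hom_mult[of "l ^ s" p] by simp
qed

theorem proposition3p2:
  fixes d :: "'n::finite \<Rightarrow> nat"
    and D :: nat
    and A :: "('n + 'n, 'k::field) mpoly set ring"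
    and gr :: "nat \<Rightarrow> ('n + 'n, 'k) mpoly set set"
    and L :: "('n + 'n, 'k) mpoly set"
  assumes d_pos: "\<And>i. d i > 0"
    and D_def: "D = (\<Sum>i\<in>UNIV. d i) - CARD('n)"
    and char: "CHAR('k) = 0 \<or> CHAR('k) > D"
    and A_def: "A = whisker_algebra complete_graph d"
    and gr_def: "gr = whisker_component complete_graph d"
    and L_def: "L = whisker_form complete_graph d"
  shows "strong_lefschetz A gr \<and>
         L \<in> gr 1 \<and>
         (\<forall>s i. (2 * int i \<le> int D - int s \<longrightarrow> mult_injective A gr L s i) \<and>
                (\<not> 2 * int i \<le> int D - int s \<longrightarrow> mult_surjective A gr L s i))"
proof -
  let ?I = "monomial_span (whisker_monomials d) :: ('n + 'n, 'k) mpoly set"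
  note subspace_graded = subspace_monomial_span[where S = "{m. int (mon_degree m) = k}" for k, folded graded_part_def]
  have I: "ideal ?I poly_ring" by (rule ideal_monomial_span) (rule whisker_monomials_add)
  \<comment> \<open>Each \<open>d i\<close> is at least \<open>1\<close>, so the natural-number
    subtraction in \<open>D\<close> is exact.\<close>
  have "CARD('n) \<le> (\<Sum>i\<in>UNIV. d i)"
    using sum_mono[of UNIV "\<lambda>_. 1" d] d_pos by (simp add: Suc_le_eq)
  then have D: "int D = (\<Sum>i\<in>UNIV. int (d i) - 1)"
    by (simp add: D_def of_nat_diff sum_subtractf)
  have char_int: "of_int k \<noteq> (0 :: 'k)" if "0 < k" "k \<le> (\<Sum>i\<in>UNIV. int (d i) - 1)" for k
    using of_int_nonzero_CHAR[OF char] that unfolding D .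
  have L: "L = ?I +>\<^bsub>poly_ring\<^esub> linear_form"
    by (simp add: L_def whisker_form_def whisker_ideal_complete_graph linear_form_def sum_UNIV_sum)
  have gr: "gr i = (\<lambda>p. ?I +>\<^bsub>poly_ring\<^esub> p) ` graded_part (int i)" for i
    by (simp add: gr_def whisker_component_def quot_component_def whisker_ideal_complete_graph homogeneous_eq)
  have mult: "L [^]\<^bsub>A\<^esub> s \<otimes>\<^bsub>A\<^esub> (?I +>\<^bsub>poly_ring\<^esub> p) = ?I +>\<^bsub>poly_ring\<^esub> (linear_form ^ s * p)"
    for s :: nat and p
    unfolding A_def whisker_algebra_def L whisker_ideal_complete_graph by (rule coset_pow_mult[OF I])
  have L_gr: "L \<in> gr 1"
    by (auto simp: gr L intro!: imageI linear_form_graded_part)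
  have inj: "mult_injective A gr L s i" if "2 * int i \<le> int D - int s" for s i
    unfolding mult_injective_def gr
  proof (rule inj_onI, clarify)
    fix p q :: "('n + 'n, 'k) mpoly"
    assume pq: "p \<in> graded_part (int i)" "q \<in> graded_part (int i)"
      and eq: "L [^]\<^bsub>A\<^esub> s \<otimes>\<^bsub>A\<^esub> (?I +>\<^bsub>poly_ring\<^esub> p) = L [^]\<^bsub>A\<^esub> s \<otimes>\<^bsub>A\<^esub> (?I +>\<^bsub>poly_ring\<^esub> q)"
    have "linear_form ^ s * (p - q) \<in> ?I"
      using eq by (simp add: mult coset_eq_iff[OF I] right_diff_distrib)
    then have "p - q \<in> ?I"
      using that unfolding D
      by (intro whisker_injective[OF d_pos char_int mpoly.subspace_diff[OF subspace_graded pq]]) auto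
    then show "?I +>\<^bsub>poly_ring\<^esub> p = ?I +>\<^bsub>poly_ring\<^esub> q" by (simp add: coset_eq_iff[OF I])
  qed
  have surj: "mult_surjective A gr L s i" if "\<not> 2 * int i \<le> int D - int s" for s i
    unfolding mult_surjective_def
  proof (intro antisym subsetI)
    show "x \<in> gr (i + s)" if "x \<in> (\<lambda>a. L [^]\<^bsub>A\<^esub> s \<otimes>\<^bsub>A\<^esub> a) ` gr i" for x
      using that by (auto simp: gr mult intro!: imageI linear_form_power_graded_part)
    fix x assume "x \<in> gr (i + s)"
    then obtain q where q: "q \<in> graded_part (int i + int s)" "x = ?I +>\<^bsub>poly_ring\<^esub> q"
      by (auto simp: gr)
    \<comment> \<open>In the target degree \<open>j = i + s\<close> the negated bound reads
      \<open>D + s < 2 * j\<close>, as \<open>whisker_surjective\<close> requires.\<close>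
    have "\<exists>p\<in>graded_part (int i + int s - int s). q - linear_form ^ s * p \<in> ?I"
      by (rule whisker_surjective[OF d_pos char_int q(1)]) (use that in \<open>auto simp: D\<close>)
    then obtain p where p: "p \<in> graded_part (int i)" "q - linear_form ^ s * p \<in> ?I" by auto
    then have "x = L [^]\<^bsub>A\<^esub> s \<otimes>\<^bsub>A\<^esub> (?I +>\<^bsub>poly_ring\<^esub> p)"
      by (simp add: q(2) mult coset_eq_iff[OF I])
    then show "x \<in> (\<lambda>a. L [^]\<^bsub>A\<^esub> s \<otimes>\<^bsub>A\<^esub> a) ` gr i"
      using p(1) by (auto simp: gr)
  qed
  show ?thesis
    unfolding strong_lefschetz_def using L_gr inj surj by blast
qed

end
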